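(* Let $(X,\sigma,\tau)$ be a solution. Then $(X,\sigma,\tau)$ is $2$-reductive if and only if it is (isomorphic to) a disjoint union, over some non-empty set $I$, of abelian groups $\mathcal A=((A_i)_{i\in I},(c_{i,j})_{i,j\in I},(d_{i,j})_{i,j\in I})$. Moreover, for a disjoint union of abelian groups, the orbits of the action of the permutation group $\mathcal{G}(X)=\langle \sigma_x,\tau_y : x,y\in X\rangle$ on $X$ are exactly the sets $A_i$, $i\in I$.
   Context: A solution is a triple $(X,\sigma,\tau)$ with $X$ a non-empty set (of arbitrary cardinality) and maps $X\times X\to X$ written $(x,y)\mapsto \sigma_x(y)$ and $(x,y)\mapsto\tau_y(x)$, such that every $\sigma_x$ and every $\tau_y$ is a bijection of $X$, and the map $r\colon X^2\to X^2$, $r(x,y)=(\sigma_x(y),\tau_y(x))$, is a bijection satisfying $(\mathrm{id}\times r)(r\times \mathrm{id})(\mathrm{id}\times r)=(r\times \mathrm{id})(\mathrm{id}\times r)(r\times \mathrm{id})$ on $X^3$. An isomorphism of solutions $(X,\sigma,\tau)\to(X',\sigma',\tau')$ is a bijection $\Phi$ with $\Phi\sigma_x=\sigma'_{\Phi(x)}\Phi$ and $\Phi\tau_x=\tau'_{\Phi(x)}\Phi$ for all $x$. A solution is $2$-reductive if for all $x,y\in X$: $\sigma_{\sigma_x(y)}=\sigma_y$, $\tau_{\tau_x(y)}=\tau_y$, $\sigma_{\tau_x(y)}=\sigma_y$, $\tau_{\sigma_x(y)}=\tau_y$. A disjoint union of abelian groups $((A_i)_{i\in I},(c_{i,j}),(d_{i,j}))$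 consists of a non-empty set $I$, abelian groups $(A_i,+)$, and constants $c_{i,j},d_{i,j}\in A_j$ for $i,j\in I$, such that each $A_j$ is generated by $\{c_{i,j},d_{i,j}: i\in I\}$; it is the solution on the disjoint union $X=\bigcup_{i\in I}A_i$ given by $\sigma_x(y)=y+c_{i,j}$ and $\tau_y(x)=x+d_{j,i}$ for $x\in A_i$, $y\in A_j$. *)

theory Defs
  imports "HOL-Algebra.Bij" "HOL-Algebra.Generated_Groups" "HOL-Algebra.Group_Action"
begin

text \<open>
  A solution is given by a carrier \<open>X\<close> and two curried families of maps, the value
  \<open>\<sigma> x y\<close> standing for $\sigma_x(y)$ and \<open>\<tau> y x\<close> for $\tau_y(x)$: in both cases the first
  argument is the index of the map. Values outside \<open>X\<close> are irrelevant, so equalities of maps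
  are equalities on \<open>X\<close>.
\<close>

definition rmap :: "('a \<Rightarrow> 'a \<Rightarrow> 'a) \<Rightarrow> ('a \<Rightarrow> 'a \<Rightarrow> 'a) \<Rightarrow> 'a \<times> 'a \<Rightarrow> 'a \<times> 'a" where
  "rmap \<sigma> \<tau> = (\<lambda>(x, y). (\<sigma> x y, \<tau> y x))"

definition id_times :: "('a \<times> 'a \<Rightarrow> 'a \<times> 'a) \<Rightarrow> 'a \<times> 'a \<times> 'a \<Rightarrow> 'a \<times> 'a \<times> 'a" where
  "id_times r = (\<lambda>(x, y, z). (x, r (y, z)))"

definition times_id :: "('a \<times> 'a \<Rightarrow> 'a \<times> 'a) \<Rightarrow> 'a \<times> 'a \<times> 'a \<Rightarrow> 'a \<times> 'a \<times> 'a" where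
  "times_id r = (\<lambda>(x, y, z). (fst (r (x, y)), snd (r (x, y)), z))"

definition solution :: "'a set \<Rightarrow> ('a \<Rightarrow> 'a \<Rightarrow> 'a) \<Rightarrow> ('a \<Rightarrow> 'a \<Rightarrow> 'a) \<Rightarrow> bool" where
  "solution X \<sigma> \<tau> \<longleftrightarrow>
     X \<noteq> {} \<and>
     (\<forall>x\<in>X. bij_betw (\<sigma> x) X X) \<and>
     (\<forall>y\<in>X. bij_betw (\<tau> y) X X) \<and>
     bij_betw (rmap \<sigma> \<tau>) (X \<times> X) (X \<times> X) \<and>
     (\<forall>t \<in> X \<times> X \<times> X.
        (id_times (rmap \<sigma> \<tau>) \<circ> times_id (rmap \<sigma> \<tau>) \<circ> id_times (rmap \<sigma> \<tau>)) t =
        (times_id (rmap \<sigma> \<tau>) \<circ> id_times (rmap \<sigma> \<tau>) \<circ> times_id (rmap \<sigma> \<tau>)) t)"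

definition isomorphism_of_solutions ::
  "'a set \<Rightarrow> ('a \<Rightarrow> 'a \<Rightarrow> 'a) \<Rightarrow> ('a \<Rightarrow> 'a \<Rightarrow> 'a) \<Rightarrow>
   'b set \<Rightarrow> ('b \<Rightarrow> 'b \<Rightarrow> 'b) \<Rightarrow> ('b \<Rightarrow> 'b \<Rightarrow> 'b) \<Rightarrow> ('a \<Rightarrow> 'b) \<Rightarrow> bool" where
  "isomorphism_of_solutions X \<sigma> \<tau> X' \<sigma>' \<tau>' \<Phi> \<longleftrightarrow>
     bij_betw \<Phi> X X' \<and>
     (\<forall>x\<in>X. \<forall>y\<in>X. \<Phi> (\<sigma> x y) = \<sigma>' (\<Phi> x) (\<Phi> y)) \<and>
     (\<forall>x\<in>X. \<forall>y\<in>X. \<Phi> (\<tau> x y) = \<tau>' (\<Phi> x) (\<Phi> y))"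

definition isomorphic_solutions ::
  "'a set \<Rightarrow> ('a \<Rightarrow> 'a \<Rightarrow> 'a) \<Rightarrow> ('a \<Rightarrow> 'a \<Rightarrow> 'a) \<Rightarrow>
   'b set \<Rightarrow> ('b \<Rightarrow> 'b \<Rightarrow> 'b) \<Rightarrow> ('b \<Rightarrow> 'b \<Rightarrow> 'b) \<Rightarrow> bool" where
  "isomorphic_solutions X \<sigma> \<tau> X' \<sigma>' \<tau>' \<longleftrightarrow>
     (\<exists>\<Phi>. isomorphism_of_solutions X \<sigma> \<tau> X' \<sigma>' \<tau>' \<Phi>)"

definition two_reductive :: "'a set \<Rightarrow> ('a \<Rightarrow> 'a \<Rightarrow> 'a) \<Rightarrow> ('a \<Rightarrow> 'a \<Rightarrow> 'a) \<Rightarrow> bool" where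
  "two_reductive X \<sigma> \<tau> \<longleftrightarrow>
     (\<forall>x\<in>X. \<forall>y\<in>X. \<forall>z\<in>X.
        \<sigma> (\<sigma> x y) z = \<sigma> y z \<and>
        \<tau> (\<tau> x y) z = \<tau> y z \<and>
        \<sigma> (\<tau> x y) z = \<sigma> y z \<and>
        \<tau> (\<sigma> x y) z = \<tau> y z)"

text \<open>
  The abelian groups are commutative groups of HOL-Algebra, hence written multiplicatively.
  The disjoint union of their carriers is the dependent sum \<open>SIGMA i:I. carrier (A i)\<close>, in which
  the copy of \<open>A i\<close> is \<open>{i} \<times> carrier (A i)\<close>.
\<close>

definition disjoint_union_data ::
  "'i set \<Rightarrow> ('i \<Rightarrow> 'b monoid) \<Rightarrow> ('i \<Rightarrow> 'i \<Rightarrow> 'b) \<Rightarrow> ('i \<Rightarrow> 'i \<Rightarrow> 'b) \<Rightarrow> bool" where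
  "disjoint_union_data I A c d \<longleftrightarrow>
     I \<noteq> {} \<and>
     (\<forall>i\<in>I. comm_group (A i)) \<and>
     (\<forall>i\<in>I. \<forall>j\<in>I. c i j \<in> carrier (A j) \<and> d i j \<in> carrier (A j)) \<and>
     (\<forall>j\<in>I. generate (A j) ({c i j | i. i \<in> I} \<union> {d i j | i. i \<in> I}) = carrier (A j))"

definition du_carrier :: "'i set \<Rightarrow> ('i \<Rightarrow> 'b monoid) \<Rightarrow> ('i \<times> 'b) set" where
  "du_carrier I A = (SIGMA i:I. carrier (A i))"

definition du_sigma ::
  "('i \<Rightarrow> 'b monoid) \<Rightarrow> ('i \<Rightarrow> 'i \<Rightarrow> 'b) \<Rightarrow> 'i \<times> 'b \<Rightarrow> 'i \<times> 'b \<Rightarrow> 'i \<times> 'b" where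
  "du_sigma A c = (\<lambda>(i, x) (j, y). (j, y \<otimes>\<^bsub>A j\<^esub> c i j))"

definition du_tau ::
  "('i \<Rightarrow> 'b monoid) \<Rightarrow> ('i \<Rightarrow> 'i \<Rightarrow> 'b) \<Rightarrow> 'i \<times> 'b \<Rightarrow> 'i \<times> 'b \<Rightarrow> 'i \<times> 'b" where
  "du_tau A d = (\<lambda>(j, y) (i, x). (i, x \<otimes>\<^bsub>A i\<^esub> d j i))"

text \<open>
  The subgroup of the symmetric group of \<open>X\<close> generated by all \<open>\<sigma> x\<close> and \<open>\<tau> y\<close>. Elements of
  \<^const>\<open>BijGroup\<close> are extensional functions, hence the restrictions to \<open>X\<close>.
\<close>

definition permutation_group ::
  "'a set \<Rightarrow> ('a \<Rightarrow> 'a \<Rightarrow> 'a) \<Rightarrow> ('a \<Rightarrow> 'a \<Rightarrow> 'a) \<Rightarrow> ('a \<Rightarrow> 'a) monoid" where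
  "permutation_group X \<sigma> \<tau> =
     (BijGroup X)
       \<lparr>carrier := generate (BijGroup X)
          ({restrict (\<sigma> x) X | x. x \<in> X} \<union> {restrict (\<tau> y) X | y. y \<in> X})\<rparr>"

definition permutation_orbits ::
  "'a set \<Rightarrow> ('a \<Rightarrow> 'a \<Rightarrow> 'a) \<Rightarrow> ('a \<Rightarrow> 'a \<Rightarrow> 'a) \<Rightarrow> 'a set set" where
  "permutation_orbits X \<sigma> \<tau> = orbits (permutation_group X \<sigma> \<tau>) X (\<lambda>g. g)"

lemma bij_betw_translation:
  assumes "\<And>i. i \<in> I \<Longrightarrow> comm_group (A i)"
    and "\<And>i. i \<in> I \<Longrightarrow> u i \<in> carrier (A i)"
  shows "bij_betw (\<lambda>(i, x). (i, x \<otimes>\<^bsub>A i\<^esub> u i)) (du_carrier I A) (du_carrier I A)"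
  by (rule bij_betw_byWitness[where f' = "\<lambda>(i, x). (i, x \<otimes>\<^bsub>A i\<^esub> inv\<^bsub>A i\<^esub> (u i))"])
     (use assms in \<open>auto simp: du_carrier_def comm_group_def group.is_monoid monoid.m_assoc
        monoid.m_closed group.inv_closed group.l_inv group.r_inv\<close>)

lemma solution_disjoint_union:
  assumes "disjoint_union_data I A c d"
  shows "solution (du_carrier I A) (du_sigma A c) (du_tau A d)"
proof -
  let ?X = "du_carrier I A" and ?s = "du_sigma A c" and ?t = "du_tau A d"
  have I: "I \<noteq> {}" and G: "\<And>i. i \<in> I \<Longrightarrow> comm_group (A i)"
    and c: "\<And>i j. i \<in> I \<Longrightarrow> j \<in> I \<Longrightarrow> c i j \<in> carrier (A j)"
    and d: "\<And>i j. i \<in> I \<Longrightarrow> j \<in> I \<Longrightarrow> d i j \<in> carrier (A j)"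
    using assms by (auto simp: disjoint_union_data_def)
  note grp = comm_group.axioms(2)[OF G] and cm = comm_group.axioms(1)[OF G]
  note mon = group.is_monoid[OF grp]
  have "?X \<noteq> {}"
    using I monoid.one_closed[OF mon] unfolding du_carrier_def by blast
  moreover have "\<forall>x\<in>?X. bij_betw (?s x) ?X ?X"
    using c G by (auto simp: du_carrier_def du_sigma_def intro!: bij_betw_translation[unfolded du_carrier_def])
  moreover have "\<forall>y\<in>?X. bij_betw (?t y) ?X ?X"
    using d G
    by (auto simp: du_carrier_def du_tau_def intro!: bij_betw_translation[unfolded du_carrier_def])
  moreover have "bij_betw (rmap ?s ?t) (?X \<times> ?X) (?X \<times> ?X)"
    by (rule bij_betw_byWitness[where f' = "\<lambda>((j, y), (i, x)).
          ((i, x \<otimes>\<^bsub>A i\<^esub> inv\<^bsub>A i\<^esub> (d j i)), (j, y \<otimes>\<^bsub>A j\<^esub> inv\<^bsub>A j\<^esub> (c i j)))"])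
       (use grp mon c d in \<open>auto simp: rmap_def du_carrier_def du_sigma_def du_tau_def
          monoid.m_assoc monoid.m_closed group.inv_closed group.l_inv group.r_inv\<close>)
  moreover have "(id_times (rmap ?s ?t) \<circ> times_id (rmap ?s ?t) \<circ> id_times (rmap ?s ?t)) t =
        (times_id (rmap ?s ?t) \<circ> id_times (rmap ?s ?t) \<circ> times_id (rmap ?s ?t)) t"
    if "t \<in> ?X \<times> ?X \<times> ?X" for t
    using that c d cm
    by (auto simp: id_times_def times_id_def rmap_def du_carrier_def du_sigma_def du_tau_def
        monoid.m_assoc[OF mon] comm_monoid.m_comm)
  ultimately show ?thesis
    unfolding solution_def by blast
qed

end

theory Submission
  imports Defs
begin

text \<open>
  In a $2$-reductive solution the maps $\sigma_x$ and $\tau_x$ depend only on the orbit of $x$, so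
  the braid relation reduces to the commutativity of all these maps: the permutation group is
  abelian. An abelian group $G$ acting on the orbit of $e$ turns it into an abelian group, by
  $ge \cdot he = gh\,e$, with neutral element $e$. Choosing a base point in every orbit, $\sigma_x$
  acts on the orbit of the base point $e$ as the translation by $\sigma_x(e)$.
\<close>

section \<open>Group-theoretic preliminaries\<close>

text \<open>Commuting with a fixed \<open>b\<close> survives products and inverses, so it passes
  from a set to the subgroup it generates. Used twice: first with \<open>b\<close> a generator, then
  with \<open>b\<close> an arbitrary element of the generated subgroup.\<close>

lemma (in group) comm_group_generate:
  assumes "S \<subseteq> carrier G"
    and comm: "\<And>a b. a \<in> S \<Longrightarrow> b \<in> S \<Longrightarrow> a \<otimes> b = b \<otimes> a"
  shows "comm_group (G\<lparr>carrier := generate G S\<rparr>)"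
proof -
  have sub: "subgroup (generate G S) G"
    by (rule generate_is_subgroup[OF assms(1)])
  have inv_comm: "inv a \<otimes> b = b \<otimes> inv a"
    if "a \<in> carrier G" "b \<in> carrier G" "a \<otimes> b = b \<otimes> a" for a b
    using that by (metis inv_closed inv_solve_left inv_solve_right m_assoc m_closed)
  have mult_comm: "(a \<otimes> a') \<otimes> b = b \<otimes> (a \<otimes> a')"
    if "a \<in> carrier G" "a' \<in> carrier G" "b \<in> carrier G" "a \<otimes> b = b \<otimes> a" "a' \<otimes> b = b \<otimes> a'"
    for a a' b
    using that by (metis m_assoc)
  have one_side: "a \<otimes> b = b \<otimes> a"
    if "a \<in> generate G T" "T \<subseteq> carrier G" "b \<in> carrier G" "\<And>t. t \<in> T \<Longrightarrow> t \<otimes> b = b \<otimes> t"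
    for a b T
    using that
  proof (induction rule: generate.induct)
    case (eng h1 h2)
    then show ?case
      using generate_in_carrier by (intro mult_comm) auto
  qed (auto intro!: inv_comm)
  have "a \<otimes> b = b \<otimes> a" if "a \<in> generate G S" "b \<in> generate G S" for a b
  proof (rule one_side[OF that(1) assms(1)])
    show "b \<in> carrier G"
      using generate_in_carrier[OF assms(1) that(2)] .
    show "t \<otimes> b = b \<otimes> t" if "t \<in> S" for t
      using one_side[OF \<open>b \<in> generate G S\<close> assms(1), of t] comm that assms(1) by auto
  qed
  then show ?thesis
    using subgroup_imp_group[OF sub] by (intro group.group_comm_groupI) auto
qed

lemma subgroup_group_action:
  assumes "subgroup H (BijGroup E)"
  shows "group_action ((BijGroup E)\<lparr>carrier := H\<rparr>) E (\<lambda>g. g)"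
  unfolding group_action_def group_hom_def group_hom_axioms_def hom_def
  using assms group.subgroup_imp_group[OF group_BijGroup assms] group_BijGroup subgroup.subset
  by auto

lemma restrict_in_BijGroup:
  assumes "bij_betw f X X"
  shows "restrict f X \<in> carrier (BijGroup X)"
  using assms bij_betw_cong[of X "restrict f X" f X] by (simp add: BijGroup_def Bij_def)

lemma (in group_action) orbit_eq:
  assumes "x \<in> E" "y \<in> orbit G \<phi> x"
  shows "orbit G \<phi> y = orbit G \<phi> x"
proof -
  have E: "z \<in> E" if "z \<in> orbit G \<phi> u" "u \<in> E" for z u
    using that element_image by (auto simp: orbit_def)
  show ?thesis
    using assms E orbit_sym orbit_trans by blast
qed

section \<open>Orbits of abelian group actions\<close>

text \<open>The structure of \<open>G\<close> carried over along \<open>g\<close> ->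
  \<open>\<phi> g e\<close>. \<open>SOME\<close> picks one group element taking \<open>e\<close> to
  \<open>x\<close>; for commutative \<open>G\<close> the choice is immaterial by
  \<open>mult_orbit_group\<close>.\<close>

definition orbit_group ::
  "('g, 'm) monoid_scheme \<Rightarrow> ('g \<Rightarrow> 'a \<Rightarrow> 'a) \<Rightarrow> 'a \<Rightarrow> 'a monoid" where
  "orbit_group G \<phi> e =
     \<lparr>carrier = orbit G \<phi> e,
      mult = (\<lambda>x y. \<phi> (SOME g. g \<in> carrier G \<and> \<phi> g e = x) y),
      one = e\<rparr>"

lemma carrier_orbit_group [simp]: "carrier (orbit_group G \<phi> e) = orbit G \<phi> e"
  by (simp add: orbit_group_def)

locale comm_group_action = group_action + comm_group G
begin

lemma action_commute:
  assumes "x \<in> E" "g \<in> carrier G" "h \<in> carrier G"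
  shows "\<phi> g (\<phi> h x) = \<phi> h (\<phi> g x)"
  using assms composition_rule m_comm by metis

text \<open>In an abelian group, two elements that agree at \<open>e\<close> agree on the whole
  orbit of \<open>e\<close>: writing \<open>y\<close> as \<open>\<phi> k e\<close>, the action of
  \<open>k\<close> can be moved outside.\<close>

lemma mult_orbit_group:
  assumes "e \<in> E" "g \<in> carrier G" "y \<in> orbit G \<phi> e"
  shows "\<phi> g e \<otimes>\<^bsub>orbit_group G \<phi> e\<^esub> y = \<phi> g y"
proof -
  let ?h = "SOME h. h \<in> carrier G \<and> \<phi> h e = \<phi> g e"
  have h: "?h \<in> carrier G \<and> \<phi> ?h e = \<phi> g e"
    by (rule someI[of _ g]) (use assms in auto)
  obtain k where k: "k \<in> carrier G" "y = \<phi> k e"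
    using assms(3) by (auto simp: orbit_def)
  have "\<phi> ?h y = \<phi> k (\<phi> ?h e)"
    using action_commute assms(1) h k by auto
  also have "\<dots> = \<phi> g y"
    using action_commute assms h k by auto
  finally show ?thesis
    by (simp add: orbit_group_def)
qed

lemma orbit_map_hom:
  assumes "e \<in> E"
  shows "(\<lambda>g. \<phi> g e) \<in> hom G (orbit_group G \<phi> e)"
proof (rule homI)
  fix g h assume "g \<in> carrier G" "h \<in> carrier G"
  moreover from this have "\<phi> h e \<in> orbit G \<phi> e"
    by (auto simp: orbit_def)
  ultimately show "\<phi> (g \<otimes> h) e = \<phi> g e \<otimes>\<^bsub>orbit_group G \<phi> e\<^esub> \<phi> h e"
    using assms by (simp add: composition_rule mult_orbit_group)
qed (auto simp: orbit_def)

text \<open>The orbit is the image of the commutative group \<open>G\<close> under the homomorphism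
  \<open>orbit_map_hom\<close>.\<close>

lemma comm_group_orbit_group:
  assumes "e \<in> E"
  shows "comm_group (orbit_group G \<phi> e)"
proof -
  have "\<phi> \<one> e = e"
    using assms id_eq_one by (metis restrict_apply')
  moreover have "(\<lambda>g. \<phi> g e) ` carrier G = orbit G \<phi> e"
    by (auto simp: orbit_def)
  ultimately have "(orbit_group G \<phi> e)\<lparr>carrier := (\<lambda>g. \<phi> g e) ` carrier G, one := \<phi> \<one> e\<rparr> =
      orbit_group G \<phi> e"
    by (simp add: orbit_group_def)
  then show ?thesis
    using hom_imp_img_comm_group[OF orbit_map_hom[OF assms]] by simp
qed

text \<open>A homomorphism maps generators to generators of its image. This supplies the generation
  condition on the groups of a disjoint union.\<close>

lemma generate_orbit_group:
  assumes "e \<in> E" "S \<subseteq> carrier G" "generate G S = carrier G"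
  shows "generate (orbit_group G \<phi> e) ((\<lambda>g. \<phi> g e) ` S) = orbit G \<phi> e"
proof -
  interpret group_hom G "orbit_group G \<phi> e" "\<lambda>g. \<phi> g e"
    using comm_group_orbit_group[OF assms(1)] orbit_map_hom[OF assms(1)] is_group
    by (simp add: group_hom_def group_hom_axioms_def comm_group_def)
  show ?thesis
    using generate_img[OF assms(2)] assms(3) by (auto simp: orbit_def)
qed

end

section \<open>Disjoint unions of abelian groups\<close>

text \<open>The map attached to a point depends only on its summand, and translations preserve
  summands.\<close>

lemma two_reductive_disjoint_union:
  "two_reductive (du_carrier I A) (du_sigma A c) (du_tau A d)"
  by (auto simp: two_reductive_def du_carrier_def du_sigma_def du_tau_def)

lemma two_reductive_isomorphic:
  assumes "solution X \<sigma> \<tau>" "isomorphic_solutions X \<sigma> \<tau> X' \<sigma>' \<tau>'" "two_reductive X' \<sigma>' \<tau>'"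
  shows "two_reductive X \<sigma> \<tau>"
proof -
  obtain \<Phi> where bij: "bij_betw \<Phi> X X'"
    and \<sigma>: "\<And>x y. x \<in> X \<Longrightarrow> y \<in> X \<Longrightarrow> \<Phi> (\<sigma> x y) = \<sigma>' (\<Phi> x) (\<Phi> y)"
    and \<tau>: "\<And>x y. x \<in> X \<Longrightarrow> y \<in> X \<Longrightarrow> \<Phi> (\<tau> x y) = \<tau>' (\<Phi> x) (\<Phi> y)"
    using assms(2) by (auto simp: isomorphic_solutions_def isomorphism_of_solutions_def)
  have X: "\<sigma> x y \<in> X" "\<tau> x y \<in> X" if "x \<in> X" "y \<in> X" for x y
    using assms(1) that bij_betwE unfolding solution_def by blast+
  have X': "\<Phi> x \<in> X'" if "x \<in> X" for x
    using bij that bij_betwE by blast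
  \<comment> \<open>The identities hold after applying \<open>\<Phi>\<close>; injectivity on
    \<open>X\<close> pulls them back, which is why \<open>X\<close> has to be closed under both
    operations.\<close>
  have eq: "a = b" if "a \<in> X" "b \<in> X" "\<Phi> a = \<Phi> b" for a b
    using bij that by (auto simp: bij_betw_def inj_on_def)
  show ?thesis
    using assms(3) unfolding two_reductive_def
    by (auto intro!: eq simp: X X' \<sigma> \<tau>)
qed

section \<open>The permutation group and its action\<close>

lemma subgroup_permutation_group:
  assumes "solution X \<sigma> \<tau>"
  shows "subgroup (carrier (permutation_group X \<sigma> \<tau>)) (BijGroup X)"
  unfolding permutation_group_def
  using assms restrict_in_BijGroup
  by (auto simp: solution_def intro!: group.generate_is_subgroup[OF group_BijGroup])

lemma permutation_group_action:
  assumes "solution X \<sigma> \<tau>"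
  shows "group_action (permutation_group X \<sigma> \<tau>) X (\<lambda>g. g)"
  using subgroup_group_action[OF subgroup_permutation_group[OF assms]]
  by (simp add: permutation_group_def)

lemma restrict_in_permutation_group:
  assumes "x \<in> X"
  shows "restrict (\<sigma> x) X \<in> carrier (permutation_group X \<sigma> \<tau>)"
    and "restrict (\<tau> x) X \<in> carrier (permutation_group X \<sigma> \<tau>)"
  using assms by (auto simp: permutation_group_def intro!: generate.incl)

text \<open>By definition the carrier is generated inside \<open>BijGroup X\<close>. Here the
  generation takes place in the permutation group itself, so that induction works with its own
  products and inverses.\<close>

lemma generate_permutation_group:
  assumes "solution X \<sigma> \<tau>"
  shows "generate (permutation_group X \<sigma> \<tau>)
      ({restrict (\<sigma> x) X | x. x \<in> X} \<union> {restrict (\<tau> y) X | y. y \<in> X}) =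
    carrier (permutation_group X \<sigma> \<tau>)" (is "generate ?G ?S = _")
proof -
  have "?S \<subseteq> carrier ?G"
    using restrict_in_permutation_group[where \<sigma> = \<sigma> and \<tau> = \<tau>] by auto
  from group.generate_consistent[OF group_BijGroup this subgroup_permutation_group[OF assms]]
  show ?thesis
    by (simp add: permutation_group_def)
qed

text \<open>On the summand \<open>A j\<close>, every permutation in \<open>G\<close> is a
  translation, and every translation arises from \<open>G\<close>, because the constants generate
  \<open>A j\<close>. Translations act transitively on \<open>A j\<close>.\<close>

lemma orbit_disjoint_union:
  assumes data: "disjoint_union_data I A c d" and j: "j \<in> I" and y: "y \<in> carrier (A j)"
  defines "G \<equiv> permutation_group (du_carrier I A) (du_sigma A c) (du_tau A d)"
  shows "orbit G (\<lambda>g. g) (j, y) = {j} \<times> carrier (A j)"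
proof -
  let ?X = "du_carrier I A"
  interpret A: comm_group "A j"
    using data j by (auto simp: disjoint_union_data_def)
  have gen: "generate (A j) ({c i j | i. i \<in> I} \<union> {d i j | i. i \<in> I}) = carrier (A j)"
    and cd: "\<And>i. i \<in> I \<Longrightarrow> c i j \<in> carrier (A j)" "\<And>i. i \<in> I \<Longrightarrow> d i j \<in> carrier (A j)"
    using data j by (auto simp: disjoint_union_data_def)
  have sol: "solution ?X (du_sigma A c) (du_tau A d)"
    by (rule solution_disjoint_union[OF data])
  interpret act: group_action G ?X "\<lambda>g. g"
    unfolding G_def by (rule permutation_group_action[OF sol])
  have G: "group G"
    using act.group_hom by (simp add: group_hom_def)
  have X: "(j, z) \<in> ?X \<longleftrightarrow> z \<in> carrier (A j)" for z
    using j by (simp add: du_carrier_def)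
  \<comment> \<open>\<open>K u g\<close>: the permutation \<open>g\<close> acts on
    \<open>A j\<close> as translation by \<open>u\<close>. The relation respects units, products and
    inverses, so one induction over \<open>G\<close> and one over \<open>A j\<close> show that it is
    total on both sides.\<close>
  define K where "K u g \<longleftrightarrow> u \<in> carrier (A j) \<and> g \<in> carrier G \<and>
      (\<forall>z \<in> carrier (A j). g (j, z) = (j, z \<otimes>\<^bsub>A j\<^esub> u))" for u g
  have K_one: "K \<one>\<^bsub>A j\<^esub> \<one>\<^bsub>G\<^esub>"
    using group.is_monoid[OF G] fun_cong[OF act.id_eq_one, symmetric] X
    by (auto simp: K_def monoid.one_closed)
  have K_mult: "K (u \<otimes>\<^bsub>A j\<^esub> v) (g \<otimes>\<^bsub>G\<^esub> h)" if "K u g" "K v h" for u v g h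
    using that G X act.composition_rule
    by (auto simp: K_def group.is_monoid monoid.m_closed A.m_ac)
  have K_inv: "K (inv\<^bsub>A j\<^esub> u) (inv\<^bsub>G\<^esub> g)" if "K u g" for u g
  proof -
    have "(inv\<^bsub>G\<^esub> g) (j, z) = (j, z \<otimes>\<^bsub>A j\<^esub> inv\<^bsub>A j\<^esub> u)" if "z \<in> carrier (A j)" for z
      \<comment> \<open>It suffices that \<open>g\<close> sends the translate of \<open>z\<close> by
        the inverse of \<open>u\<close> back to \<open>z\<close>.\<close>
      by (rule act.orbit_sym_aux) (use that \<open>K u g\<close> X in \<open>auto simp: K_def A.m_assoc\<close>)
    then show ?thesis
      using that G by (auto simp: K_def)
  qed
  have K_sigma: "K (c i j) (restrict (du_sigma A c (i, x)) ?X)"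
    and K_tau: "K (d i j) (restrict (du_tau A d (i, x)) ?X)" if "(i, x) \<in> ?X" for i x
  proof -
    have "i \<in> I"
      using that by (simp add: du_carrier_def)
    moreover have "restrict (du_sigma A c (i, x)) ?X \<in> carrier G"
      "restrict (du_tau A d (i, x)) ?X \<in> carrier G"
      unfolding G_def using restrict_in_permutation_group[OF that] .
    ultimately show "K (c i j) (restrict (du_sigma A c (i, x)) ?X)"
      "K (d i j) (restrict (du_tau A d (i, x)) ?X)"
      using cd X by (auto simp: K_def du_sigma_def du_tau_def)
  qed
  have ex_K: "\<exists>u. K u g" if "g \<in> carrier G" for g
    using that unfolding G_def generate_permutation_group[OF sol, symmetric] unfolding G_def[symmetric]
  proof (induction rule: generate.induct)
    case (incl h)
    then show ?case
      using K_sigma K_tau by fast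
  next
    case (inv h)
    then have "\<exists>u. K u h"
      using K_sigma K_tau by fast
    then show ?case
      using K_inv by blast
  qed (use K_one K_mult in blast)+
  have K_ex: "\<exists>g. K u g" if "u \<in> carrier (A j)" for u
    using that unfolding gen[symmetric]
  proof (induction rule: generate.induct)
    case (incl h)
    then obtain i where i: "i \<in> I" "h = c i j \<or> h = d i j"
      by auto
    \<comment> \<open>Some point of the summand \<open>A i\<close> is needed to realise the constant
      by an actual generator of \<open>G\<close>; the neutral element serves.\<close>
    moreover from this have "(i, \<one>\<^bsub>A i\<^esub>) \<in> ?X"
      using data i by (auto simp: disjoint_union_data_def du_carrier_def comm_group_def
          group.is_monoid monoid.one_closed)
    ultimately show ?case
      using K_sigma K_tau by blast
  next
    case (inv h)
    then obtain i where i: "i \<in> I" "h = c i j \<or> h = d i j"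
      by auto
    moreover from this have "(i, \<one>\<^bsub>A i\<^esub>) \<in> ?X"
      using data i by (auto simp: disjoint_union_data_def du_carrier_def comm_group_def
          group.is_monoid monoid.one_closed)
    ultimately show ?case
      using K_sigma K_tau K_inv by blast
  qed (use K_one K_mult in blast)+
  show ?thesis
  proof (intro equalityI subsetI)
    fix p assume "p \<in> orbit G (\<lambda>g. g) (j, y)"
    then show "p \<in> {j} \<times> carrier (A j)"
      using ex_K y unfolding orbit_def K_def by fastforce
  next
    fix p assume "p \<in> {j} \<times> carrier (A j)"
    then obtain z where z: "p = (j, z)" "z \<in> carrier (A j)"
      by auto
    \<comment> \<open>The translation taking \<open>y\<close> to \<open>z\<close>.\<close>
    define u where "u = inv\<^bsub>A j\<^esub> y \<otimes>\<^bsub>A j\<^esub> z"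
    have "u \<in> carrier (A j)" "y \<otimes>\<^bsub>A j\<^esub> u = z"
      using y z by (simp_all add: u_def flip: A.m_assoc)
    moreover from this obtain g where "K u g"
      using K_ex by blast
    ultimately have "g \<in> carrier G" "p = g (j, y)"
      using y z by (auto simp: K_def)
    then show "p \<in> orbit G (\<lambda>g. g) (j, y)"
      unfolding orbit_def by blast
  qed
qed

lemma permutation_orbits_disjoint_union:
  assumes "disjoint_union_data I A c d"
  shows "permutation_orbits (du_carrier I A) (du_sigma A c) (du_tau A d) =
    {{i} \<times> carrier (A i) | i. i \<in> I}"
proof -
  \<comment> \<open>Orbits are indexed by points, so every summand must contain one in order to
    occur.\<close>
  have "carrier (A i) \<noteq> {}" if "i \<in> I" for i
    using assms that monoid.one_closed[of "A i"]
    unfolding disjoint_union_data_def comm_group_def group_def by blast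
  then show ?thesis
    using orbit_disjoint_union[OF assms]
    by (fastforce simp: permutation_orbits_def orbits_def du_carrier_def)
qed

section \<open>Two-reductive solutions\<close>

locale two_reductive_solution =
  fixes X :: "'a set" and \<sigma> \<tau> :: "'a \<Rightarrow> 'a \<Rightarrow> 'a"
  assumes solution: "solution X \<sigma> \<tau>" and two_reductive: "two_reductive X \<sigma> \<tau>"
begin

lemma closed:
  assumes "x \<in> X" "y \<in> X"
  shows "\<sigma> x y \<in> X" "\<tau> x y \<in> X"
  using solution assms bij_betwE unfolding solution_def by blast+

lemma reductive:
  assumes "x \<in> X" "y \<in> X" "z \<in> X"
  shows "\<sigma> (\<sigma> x y) z = \<sigma> y z" "\<tau> (\<tau> x y) z = \<tau> y z"
    "\<sigma> (\<tau> x y) z = \<sigma> y z" "\<tau> (\<sigma> x y) z = \<tau> y z"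
  using two_reductive assms unfolding two_reductive_def by auto

text \<open>Reductivity strips the inner operation from every index in the braid relation; its three
  components then become the three commutation laws.\<close>

lemma commute:
  assumes "x \<in> X" "y \<in> X" "z \<in> X"
  shows "\<sigma> x (\<sigma> y z) = \<sigma> y (\<sigma> x z)" "\<tau> x (\<tau> y z) = \<tau> y (\<tau> x z)"
    "\<sigma> x (\<tau> y z) = \<tau> y (\<sigma> x z)"
proof -
  have braid: "\<sigma> x (\<sigma> y z) = \<sigma> (\<sigma> x y) (\<sigma> (\<tau> y x) z)"
    "\<tau> (\<sigma> (\<tau> y x) z) (\<sigma> x y) = \<sigma> (\<tau> (\<sigma> y z) x) (\<tau> z y)"
    "\<tau> (\<tau> z y) (\<tau> (\<sigma> y z) x) = \<tau> z (\<tau> y x)"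
    if "x \<in> X" "y \<in> X" "z \<in> X" for x y z
    using solution that
    by (auto simp: solution_def id_times_def times_id_def rmap_def dest!: bspec[of _ _ "(x, y, z)"])
  show "\<sigma> x (\<sigma> y z) = \<sigma> y (\<sigma> x z)"
    using braid(1)[of x y z] assms by (simp add: reductive closed)
  show "\<tau> x (\<tau> y z) = \<tau> y (\<tau> x z)"
    using braid(3)[of z y x] assms by (simp add: reductive closed)
  show "\<sigma> x (\<tau> y z) = \<tau> y (\<sigma> x z)"
    using braid(2)[of x z y] assms by (simp add: reductive closed)
qed

section \<open>The abelian permutation group of a two-reductive solution\<close>

abbreviation "G \<equiv> permutation_group X \<sigma> \<tau>"

abbreviation "gens \<equiv> {restrict (\<sigma> x) X | x. x \<in> X} \<union> {restrict (\<tau> y) X | y. y \<in> X}"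

lemma gens_subset: "gens \<subseteq> carrier (BijGroup X)"
  using solution restrict_in_BijGroup by (auto simp: solution_def)

lemma comm_group_permutation_group: "comm_group G"
proof -
  have "a \<otimes>\<^bsub>BijGroup X\<^esub> b = b \<otimes>\<^bsub>BijGroup X\<^esub> a" if "a \<in> gens" "b \<in> gens" for a b
  proof -
    have "a (b z) = b (a z)" if "z \<in> X" for z
      using \<open>a \<in> gens\<close> \<open>b \<in> gens\<close> that closed commute by auto
    then have "compose X a b = compose X b a"
      by (auto simp: compose_def)
    then show ?thesis
      using gens_subset that by (auto simp: BijGroup_def subset_iff)
  qed
  then show ?thesis
    unfolding permutation_group_def
    using group.comm_group_generate[OF group_BijGroup gens_subset] by blast
qed

sublocale comm_group_action G X "\<lambda>g. g"
  using permutation_group_action[OF solution] comm_group_permutation_group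
  by (simp add: comm_group_action_def)

lemma gens_carrier: "gens \<subseteq> carrier G"
  using restrict_in_permutation_group[where \<sigma> = \<sigma> and \<tau> = \<tau>] by auto

lemmas generate_gens = generate_permutation_group[OF solution]

abbreviation "orb \<equiv> orbit G (\<lambda>g. g)"

lemma orbI: "g \<in> carrier G \<Longrightarrow> g x \<in> orb x"
  by (auto simp: orbit_def)

lemma orb_closed: "x \<in> X \<Longrightarrow> y \<in> orb x \<Longrightarrow> y \<in> X"
  using element_image by (auto simp: orbit_def)

text \<open>Reductivity is the case of a single generator; induction extends it to all of
  \<open>G\<close>.\<close>

lemma orbit_invariant:
  assumes "x \<in> X" "y \<in> orb x" "z \<in> X"
  shows "\<sigma> y z = \<sigma> x z" "\<tau> y z = \<tau> x z"
proof -
  have same: "\<sigma> (g x) z = \<sigma> x z \<and> \<tau> (g x) z = \<tau> x z"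
    if "g \<in> generate G gens" "x \<in> X" for g x
    using that
  \<comment> \<open>The point must vary: for a product, the hypothesis on \<open>h1\<close> is
    applied at \<open>h2 x\<close>.\<close>
  proof (induction arbitrary: x rule: generate.induct)
    case one
    then show ?case
      using id_eq_one by (metis restrict_apply')
  next
    case (incl h)
    then show ?case
      using assms(3) by (auto simp: reductive)
  next
    case (inv h)
    then have h: "h \<in> carrier G"
      using gens_carrier by blast
    then have ix: "(inv\<^bsub>G\<^esub> h) x \<in> X"
      using inv.prems element_image by blast
    \<comment> \<open>For an inverse, reductivity for \<open>h\<close> at the preimage of
      \<open>x\<close> compares that preimage with \<open>x\<close>.\<close>
    have "h ((inv\<^bsub>G\<^esub> h) x) = x"
      using orbit_sym_aux[of "inv\<^bsub>G\<^esub> h" x] h inv.prems by simp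
    moreover have "\<sigma> (h w) z = \<sigma> w z \<and> \<tau> (h w) z = \<tau> w z" if "w \<in> X" for w
      using inv.hyps that assms(3) by (auto simp: reductive)
    ultimately show ?case
      using ix by metis
  next
    case (eng h1 h2)
    then have "h1 \<in> carrier G" "h2 \<in> carrier G"
      using generate_gens by blast+
    then have "(h1 \<otimes>\<^bsub>G\<^esub> h2) x = h1 (h2 x)" "h2 x \<in> X"
      using eng.prems composition_rule element_image by blast+
    then show ?case
      using eng.IH eng.prems by simp
  qed
  show "\<sigma> y z = \<sigma> x z" "\<tau> y z = \<tau> x z"
    using assms same generate_gens by (auto simp: orbit_def)
qed

section \<open>Base points of orbits and the isomorphism\<close>

definition base :: "'a \<Rightarrow> 'a" where
  "base x = (SOME y. y \<in> orb x)"

lemma base_in_orbit: "x \<in> X \<Longrightarrow> base x \<in> orb x"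
  unfolding base_def using orbit_refl by (rule someI)

text \<open>The choice in \<open>base\<close> depends only on the orbit as a set, and points of one
  orbit have the same orbit.\<close>

lemma base_eq: "x \<in> X \<Longrightarrow> y \<in> orb x \<Longrightarrow> base y = base x"
  by (simp add: base_def orbit_eq)

lemma base_closed: "x \<in> X \<Longrightarrow> base x \<in> X"
  using base_in_orbit orb_closed by blast

lemma orbit_base: "x \<in> X \<Longrightarrow> x \<in> orb (base x)"
  using base_in_orbit base_closed orbit_sym by blast

abbreviation "A \<equiv> orbit_group G (\<lambda>g. g)"

text \<open>The index set consists of the base points, the group at \<open>e\<close> is its orbit
  with neutral element \<open>e\<close>, and the constants are the values
  \<open>\<sigma> i e\<close> and \<open>\<tau> i e\<close> themselves.\<close>

lemma disjoint_union_data_orbits: "disjoint_union_data (base ` X) A \<sigma> \<tau>"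
proof -
  have mem: "\<sigma> x y \<in> orb y" "\<tau> x y \<in> orb y" if "x \<in> X" "y \<in> X" for x y
    using orbI[OF restrict_in_permutation_group(1)[OF that(1), of \<sigma> \<tau>], of y]
      orbI[OF restrict_in_permutation_group(2)[OF that(1), of \<tau> \<sigma>], of y] that(2)
    by auto
  have "generate (A j) ({\<sigma> i j | i. i \<in> base ` X} \<union> {\<tau> i j | i. i \<in> base ` X}) = orb j"
    if "j \<in> X" for j
  proof -
    \<comment> \<open>Letting the index run over base points only loses no generator.\<close>
    have "\<sigma> (base x) j = \<sigma> x j \<and> \<tau> (base x) j = \<tau> x j" if "x \<in> X" for x
      using orbit_invariant[of x "base x" j] base_in_orbit that \<open>j \<in> X\<close> by simp
    then have "{\<sigma> i j | i. i \<in> base ` X} \<union> {\<tau> i j | i. i \<in> base ` X} = (\<lambda>g. g j) ` gens"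
      using that by (simp add: setcompr_eq_image image_Un image_image cong: image_cong)
    then show ?thesis
      using generate_orbit_group[OF that gens_carrier generate_gens] by simp
  qed
  then show ?thesis
    using solution mem base_closed comm_group_orbit_group
    by (auto simp: disjoint_union_data_def solution_def)
qed

text \<open>The isomorphism leaves each point as it is and tags it with the base point of its
  orbit.\<close>

lemma isomorphic_disjoint_union:
  "isomorphic_solutions X \<sigma> \<tau> (du_carrier (base ` X) A) (du_sigma A \<sigma>) (du_tau A \<tau>)"
proof -
  let ?\<Phi> = "\<lambda>x. (base x, x)"
  have "bij_betw ?\<Phi> X (du_carrier (base ` X) A)"
  proof (rule bij_betw_byWitness[where f' = snd])
    show "\<forall>a\<in>du_carrier (base ` X) A. ?\<Phi> (snd a) = a"
      using base_eq base_closed base_in_orbit by (auto simp: du_carrier_def) metis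
    show "?\<Phi> ` X \<subseteq> du_carrier (base ` X) A"
      using orbit_base by (auto simp: du_carrier_def)
    show "snd ` du_carrier (base ` X) A \<subseteq> X"
      using orb_closed[OF base_closed] by (auto simp: du_carrier_def)
  qed auto
  \<comment> \<open>Every \<open>g\<close> in \<open>G\<close> translates the orbit of
    \<open>e = base y\<close> by \<open>g e\<close>: if \<open>y = h e\<close>, then
    \<open>g y = h (g e)\<close>, which is the product of \<open>h e\<close> and
    \<open>g e\<close>.\<close>
  moreover have translation:
    "y \<otimes>\<^bsub>A (base y)\<^esub> g (base y) = g y \<and> base (g y) = base y"
    if g: "g \<in> carrier G" and y: "y \<in> X" for g y
  proof -
    obtain h where h: "h \<in> carrier G" "y = h (base y)"
      using orbit_base[OF y] by (auto simp: orbit_def)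
    have "g y = h (g (base y))"
      using action_commute[OF base_closed[OF y] g h(1)] h(2) by simp
    also have "\<dots> = y \<otimes>\<^bsub>A (base y)\<^esub> g (base y)"
      using mult_orbit_group[OF base_closed[OF y] h(1) orbI[OF g]] h(2) by simp
    finally show ?thesis
      using base_eq[OF y orbI[OF g]] by simp
  qed
  \<comment> \<open>The constants are indexed by \<open>base x\<close>;
    \<open>orbit_invariant\<close> allows replacing it by \<open>x\<close>.\<close>
  have "y \<otimes>\<^bsub>A (base y)\<^esub> \<sigma> (base x) (base y) = \<sigma> x y \<and> base (\<sigma> x y) = base y"
    "y \<otimes>\<^bsub>A (base y)\<^esub> \<tau> (base x) (base y) = \<tau> x y \<and> base (\<tau> x y) = base y"
    if "x \<in> X" "y \<in> X" for x y
    using translation[OF restrict_in_permutation_group(1)[OF that(1)] that(2)]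
      translation[OF restrict_in_permutation_group(2)[OF that(1)] that(2)]
      that base_closed orbit_invariant[OF that(1) base_in_orbit[OF that(1)]]
    by auto
  ultimately show ?thesis
    unfolding isomorphic_solutions_def isomorphism_of_solutions_def du_sigma_def du_tau_def
    by (intro exI[of _ ?\<Phi>]) auto
qed

end

text \<open>The existential fixes the type \<open>'a\<close> for indices and group elements, which
  suffices because base points and orbits lie in \<open>X\<close>. The converse is stated in
  addition for arbitrary types \<open>'i\<close> and \<open>'b\<close>.\<close>

theorem theorem3p9:
  fixes X :: "'a set" and \<sigma> \<tau> :: "'a \<Rightarrow> 'a \<Rightarrow> 'a"
  shows
    "(solution X \<sigma> \<tau> \<longrightarrow>
       (two_reductive X \<sigma> \<tau> \<longleftrightarrow>
         (\<exists>(I :: 'a set) (A :: 'a \<Rightarrow> 'a monoid) c d.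
            disjoint_union_data I A c d \<and>
            isomorphic_solutions X \<sigma> \<tau>
              (du_carrier I A) (du_sigma A c) (du_tau A d))) \<and>
       (\<forall>(I :: 'i set) (A :: 'i \<Rightarrow> 'b monoid) c d.
            disjoint_union_data I A c d \<and>
            isomorphic_solutions X \<sigma> \<tau>
              (du_carrier I A) (du_sigma A c) (du_tau A d) \<longrightarrow>
            two_reductive X \<sigma> \<tau>)) \<and>
     (\<forall>(I :: 'i set) (A :: 'i \<Rightarrow> 'b monoid) c d.
        disjoint_union_data I A c d \<longrightarrow>
        permutation_orbits (du_carrier I A) (du_sigma A c) (du_tau A d) =
          {{i} \<times> carrier (A i) | i. i \<in> I})"
proof (intro conjI impI iffI allI)
  assume "solution X \<sigma> \<tau>" "two_reductive X \<sigma> \<tau>"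
  then interpret two_reductive_solution X \<sigma> \<tau>
    by unfold_locales
  show "\<exists>(I :: 'a set) (A :: 'a \<Rightarrow> 'a monoid) c d. disjoint_union_data I A c d \<and>
      isomorphic_solutions X \<sigma> \<tau> (du_carrier I A) (du_sigma A c) (du_tau A d)"
    using disjoint_union_data_orbits isomorphic_disjoint_union by blast
next
  assume "solution X \<sigma> \<tau>" and ex: "\<exists>(I :: 'a set) (A :: 'a \<Rightarrow> 'a monoid) c d.
      disjoint_union_data I A c d \<and>
      isomorphic_solutions X \<sigma> \<tau> (du_carrier I A) (du_sigma A c) (du_tau A d)"
  from ex obtain I :: "'a set" and A :: "'a \<Rightarrow> 'a monoid" and c d
    where "isomorphic_solutions X \<sigma> \<tau> (du_carrier I A) (du_sigma A c) (du_tau A d)"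
    by blast
  then show "two_reductive X \<sigma> \<tau>"
    using two_reductive_isomorphic[OF \<open>solution X \<sigma> \<tau>\<close>] two_reductive_disjoint_union by metis
next
  fix I :: "'i set" and A :: "'i \<Rightarrow> 'b monoid" and c d
  assume "solution X \<sigma> \<tau>" "disjoint_union_data I A c d \<and>
      isomorphic_solutions X \<sigma> \<tau> (du_carrier I A) (du_sigma A c) (du_tau A d)"
  then show "two_reductive X \<sigma> \<tau>"
    using two_reductive_isomorphic two_reductive_disjoint_union by metis
next
  fix I :: "'i set" and A :: "'i \<Rightarrow> 'b monoid" and c d
  assume "disjoint_union_data I A c d"
  then show "permutation_orbits (du_carrier I A) (du_sigma A c) (du_tau A d) =
      {{i} \<times> carrier (A i) | i. i \<in> I}"
    by (rule permutation_orbits_disjoint_union)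
qed

end
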